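(* Let $n \ge 1$, let $\mathbf{K} = [-1,1]^n$, and let $f : \mathbf{K} \to \mathbb{R}$ be continuous with modulus of continuity $\omega_f$. Let $(K_r)_{r \in \mathbb{N}}$ be a family of kernels satisfying the following four conditions: (P1) for every $r$ there are real numbers $g_\alpha$ ($\alpha \in \mathbb{N}^n_r$), possibly depending on $r$, such that $K_r(\mathbf{x},\mathbf{y}) = \sum_{\alpha \in \mathbb{N}^n_r} g_\alpha T_\alpha(\mathbf{x}) T_\alpha(\mathbf{y})$; (P2) $K_r(\mathbf{x},\mathbf{y}) \ge 0$ for all $(\mathbf{x},\mathbf{y}) \in \mathbf{K}\times\mathbf{K}$ and all $r$; (P3) $\int_{\mathbf{K}} K_r(\mathbf{x},\mathbf{y})\,\mathrm{d}\mu(\mathbf{y}) = 1$ for all $\mathbf{x} \in \mathbf{K}$ and all $r$; (P4) $\lim_{r\to\infty} \sigma_r = 0$, where $\sigma_r$ is the resolution of $K_r$. Then $\mathcal{K}^{(r)}(f) \to f$ as $r \to \infty$, uniformly on $\mathbf{K}$. Moreover, for every $r$, $$\|\mathcal{K}^{(r)}(f) - f\|_{\infty,\mathbf{K}} \le 2\left(1 + \frac{\pi}{\sqrt{2}}\right)\omega_f(\sigma_r).$$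
   Context: Notation. $\mathbb{N}$ includes $0$ and $\mathbb{N}^n_r = \{\alpha \in \mathbb{N}^n : \alpha_1 + \dots + \alpha_n \le r\}$. $\|\cdot\|$ is the Euclidean norm on $\mathbb{R}^n$, and $\|h\|_{\infty,\mathbf{K}} = \sup_{\mathbf{x}\in\mathbf{K}} |h(\mathbf{x})|$. The measure $\mu$ on $\mathbf{K} = [-1,1]^n$ is $$\mathrm{d}\mu(\mathbf{x}) = \prod_{i=1}^n \frac{1}{\pi\sqrt{1-x_i^2}}\,\mathrm{d}\mathbf{x}.$$ For $k \in \mathbb{N}$, $T_k$ is the univariate Chebyshev polynomial of the first kind, $T_k(x) = \cos(k\arccos x)$ for $x \in [-1,1]$; for $\alpha \in \mathbb{N}^n$, $T_\alpha(\mathbf{x}) = \prod_{i=1}^n T_{\alpha_i}(x_i)$. The convolution operator associated with $K_r$ is $$\mathcal{K}^{(r)}(f)(\mathbf{x}) = \int_{\mathbf{K}} f(\mathbf{y}) K_r(\mathbf{x},\mathbf{y})\,\mathrm{d}\mu(\mathbf{y}).$$ The resolution of $K_r$ is $$\sigma_r = \left(\int_{\mathbf{K}\times\mathbf{K}} \|\mathbf{x}-\mathbf{y}\|^2 K_r(\mathbf{x},\mathbf{y})\,\mathrm{d}\mu(\mathbf{x})\,\mathrm{d}\mu(\mathbf{y})\right)^{1/2}.$$ The modulus of continuity of a continuous $f : \mathbf{K} \to \mathbb{R}$ is $$\omega_f(\delta) = \max_{\mathbf{x},\mathbf{y}\in\mathbf{K},\ \|\mathbf{x}-\mathbf{y}\|\le\delta}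 |f(\mathbf{x}) - f(\mathbf{y})|.$$ *)

theory Defs
  imports "HOL-Analysis.Analysis"
begin

definition cube :: "(real^'n) set" where
  "cube = {x. \<forall>i. -1 \<le> x $ i \<and> x $ i \<le> 1}"

text \<open>
  The measure lives on the cube itself (its space is \<^term>\<open>cube\<close>), so integrals against it do not
  depend on the values of the integrand outside the cube. On the null set where some
  coordinate is \<open>1\<close> or \<open>-1\<close> the density is \<open>0\<close>, because \<open>x / 0 = 0\<close>.
\<close>

definition cheb_measure :: "(real^'n) measure" where
  "cheb_measure =
     density (restrict_space lborel cube)
       (\<lambda>x. ennreal (\<Prod>i\<in>UNIV. 1 / (pi * sqrt (1 - (x $ i)\<^sup>2))))"

fun cheb_poly :: "nat \<Rightarrow> real poly" where
  "cheb_poly 0 = 1"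
| "cheb_poly (Suc 0) = [:0, 1:]"
| "cheb_poly (Suc (Suc k)) = [:0, 2:] * cheb_poly (Suc k) - cheb_poly k"

lemma poly_cheb_poly:
  assumes "-1 \<le> x" "x \<le> 1"
  shows "poly (cheb_poly k) x = cos (real k * arccos x)"
proof (induction k rule: cheb_poly.induct)
  case (3 k)
  let ?t = "arccos x"
  have x: "cos ?t = x"
    using assms by simp
  have "cos (real (Suc (Suc k)) * ?t) + cos (real k * ?t) = 2 * x * cos (real (Suc k) * ?t)"
  proof -
    have 1: "real (Suc (Suc k)) * ?t = real (Suc k) * ?t + ?t"
      and 2: "real k * ?t = real (Suc k) * ?t - ?t"
      by (simp_all add: algebra_simps)
    show ?thesis
      unfolding 1 2 cos_add cos_diff x by simp
  qed
  then show ?case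
    using 3 by simp
qed (use assms in simp_all)

definition cheb :: "nat^'n \<Rightarrow> real^'n \<Rightarrow> real" where
  "cheb \<alpha> x = (\<Prod>i\<in>UNIV. poly (cheb_poly (\<alpha> $ i)) (x $ i))"

definition multi_indices :: "nat \<Rightarrow> (nat^'n) set" where
  "multi_indices r = {\<alpha>. (\<Sum>i\<in>UNIV. \<alpha> $ i) \<le> r}"

lemma finite_multi_indices: "finite (multi_indices r :: (nat^'n) set)"
proof (rule finite_subset)
  show "multi_indices r \<subseteq> vec_lambda ` ((UNIV :: 'n set) \<rightarrow>\<^sub>E {..r})"
  proof
    fix \<alpha> :: "nat^'n"
    assume "\<alpha> \<in> multi_indices r"
    then have "\<alpha> $ i \<le> r" for i
      using member_le_sum[of i UNIV "\<lambda>i. \<alpha> $ i"] by (simp add: multi_indices_def)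
    then have "vec_nth \<alpha> \<in> UNIV \<rightarrow>\<^sub>E {..r}"
      by auto
    then show "\<alpha> \<in> vec_lambda ` ((UNIV :: 'n set) \<rightarrow>\<^sub>E {..r})"
      by (metis image_eqI vec_nth_inverse)
  qed
  show "finite (vec_lambda ` ((UNIV :: 'n set) \<rightarrow>\<^sub>E {..r}))"
    by (intro finite_imageI finite_PiE) auto
qed

definition convolution :: "(real^'n \<Rightarrow> real^'n \<Rightarrow> real) \<Rightarrow> (real^'n \<Rightarrow> real) \<Rightarrow> real^'n \<Rightarrow> real" where
  "convolution k f x = (LINT y|cheb_measure. f y * k x y)"

definition resolution :: "(real^'n \<Rightarrow> real^'n \<Rightarrow> real) \<Rightarrow> real" where
  "resolution k =
     sqrt (LINT z|(cheb_measure \<Otimes>\<^sub>M cheb_measure). (norm (fst z - snd z))\<^sup>2 * k (fst z) (snd z))"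

text \<open>
  The maximum is written as a supremum, the type \<^typ>\<open>real\<close> having no maximum operator for infinite
  sets; it is attained by the lemma that follows.
\<close>

definition modulus_of_continuity :: "(real^'n \<Rightarrow> real) \<Rightarrow> real \<Rightarrow> real" where
  "modulus_of_continuity f \<delta> =
     Sup {\<bar>f x - f y\<bar> | x y. x \<in> cube \<and> y \<in> cube \<and> norm (x - y) \<le> \<delta>}"

lemma cube_eq_cbox: "cube = cbox (-1) (1 :: real^'n)"
  by (auto simp: cube_def mem_box_cart)

lemma modulus_of_continuity_attained:
  fixes f :: "real^'n \<Rightarrow> real"
  assumes f: "continuous_on cube f" and "0 \<le> \<delta>"
  obtains x y where "x \<in> cube" "y \<in> cube" "norm (x - y) \<le> \<delta>"
    "modulus_of_continuity f \<delta> = \<bar>f x - f y\<bar>"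
    "\<And>x' y'. x' \<in> cube \<Longrightarrow> y' \<in> cube \<Longrightarrow> norm (x' - y') \<le> \<delta> \<Longrightarrow> \<bar>f x' - f y'\<bar> \<le> \<bar>f x - f y\<bar>"
proof -
  define S :: "((real^'n) \<times> (real^'n)) set"
    where "S = (cube \<times> cube) \<inter> {z. norm (fst z - snd z) \<le> \<delta>}"
  have "closed {z :: (real^'n) \<times> (real^'n). norm (fst z - snd z) \<le> \<delta>}"
    by (intro closed_Collect_le continuous_intros)
  then have "compact S"
    unfolding S_def cube_eq_cbox by (intro compact_Int_closed compact_Times compact_cbox)
  moreover have "(0, 0) \<in> S"
    using assms by (simp add: S_def cube_def)
  moreover have "continuous_on S (\<lambda>z. \<bar>f (fst z) - f (snd z)\<bar>)"
    by (intro continuous_intros continuous_on_compose2[OF f]) (auto simp: S_def)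
  ultimately obtain z where z: "z \<in> S"
    and max: "\<And>w. w \<in> S \<Longrightarrow> \<bar>f (fst w) - f (snd w)\<bar> \<le> \<bar>f (fst z) - f (snd z)\<bar>"
    using continuous_attains_sup[of S "\<lambda>z. \<bar>f (fst z) - f (snd z)\<bar>"] by blast
  have zS: "fst z \<in> cube" "snd z \<in> cube" "norm (fst z - snd z) \<le> \<delta>"
    using z by (auto simp: S_def mem_Times_iff)
  have le: "\<bar>f x' - f y'\<bar> \<le> \<bar>f (fst z) - f (snd z)\<bar>"
    if "x' \<in> cube" "y' \<in> cube" "norm (x' - y') \<le> \<delta>" for x' y'
    using max[of "(x', y')"] that by (simp add: S_def)
  have "modulus_of_continuity f \<delta> = \<bar>f (fst z) - f (snd z)\<bar>"
    unfolding modulus_of_continuity_def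
  proof (rule cSup_eq_maximum)
    show "\<bar>f (fst z) - f (snd z)\<bar> \<in> {\<bar>f x - f y\<bar> | x y. x \<in> cube \<and> y \<in> cube \<and> norm (x - y) \<le> \<delta>}"
      using zS by blast
  qed (use le in blast)
  with zS le show ?thesis
    using that by blast
qed

text \<open>As a supremum of reals this is meaningful only for functions that are bounded on the cube.\<close>

definition sup_norm_cube :: "(real^'n \<Rightarrow> real) \<Rightarrow> real" where
  "sup_norm_cube h = (SUP x\<in>cube. \<bar>h x\<bar>)"

end

theory Submission
  imports Defs
begin

text \<open>
  Fix \<open>r\<close> and write \<open>k = K\<^sub>r\<close>. Orthogonality makes every Chebyshev polynomial an eigenfunction of the
  convolution, so the second moment of the probability density \<open>k x\<close> about \<open>x\<close> can be computed from
  the first two moments of \<open>k 1\<close>. Comparing it with its average over the cube, which is \<open>\<sigma>\<^sup>2\<close>, shows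
  that it is at most \<open>2 \<sigma>\<^sup>2\<close> at every point \<open>x\<close>. Integrating the inequality
  \<open>\<bar>f x - f y\<bar> \<le> (1 + \<parallel>x - y\<parallel>\<^sup>2 / \<delta>\<^sup>2) \<omega>(\<delta>)\<close> against \<open>k x\<close> bounds the error at \<open>x\<close> by
  \<open>(1 + 2 \<sigma>\<^sup>2 / \<delta>\<^sup>2) \<omega>(\<delta>)\<close>, which is \<open>3 \<omega>(\<sigma>)\<close> for \<open>\<delta> = \<sigma>\<close>.
\<close>

section \<open>The Chebyshev measure\<close>

text \<open>The arcsine density, extended by 0 to the whole line so that its integrals can be taken
  against \<open>lborel\<close>. At the endpoints it is 0, by division by zero.\<close>

definition cheb_weight :: "real \<Rightarrow> real" where
  "cheb_weight t = indicator {-1..1} t / (pi * sqrt (1 - t\<^sup>2))"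

lemma cheb_weight_nonneg: "0 \<le> cheb_weight t"
  by (auto simp: cheb_weight_def indicator_def abs_square_le_1)

lemma borel_measurable_cheb_weight [measurable]: "cheb_weight \<in> borel_measurable borel"
  unfolding cheb_weight_def by measurable

text \<open>Substituting t = cos u would turn this into the mean of cos(m u) over [0, pi]; here the
  antiderivative is given directly. The interior form of the fundamental theorem copes with the
  singular endpoints. An integer \<open>m\<close> allows differences of degrees.\<close>

lemma has_integral_cheb_weight_cos:
  fixes m :: int
  shows "((\<lambda>t. cheb_weight t * cos (m * arccos t)) has_integral (if m = 0 then 1 else 0)) {-1..1}"
proof (cases "m = 0")
  case True
  have "((\<lambda>t. 1 / (pi * sqrt (1 - t\<^sup>2))) has_integral (- arccos 1 / pi - (- arccos (-1) / pi))) {-1..1}"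
  proof (rule fundamental_theorem_of_calculus_interior)
    fix t :: real
    assume "t \<in> {-1<..<1}"
    then have "DERIV (\<lambda>t. - arccos t / pi) t :> 1 / (pi * sqrt (1 - t\<^sup>2))"
      by (auto intro!: derivative_eq_intros simp: field_simps)
    then show "((\<lambda>t. - arccos t / pi) has_vector_derivative 1 / (pi * sqrt (1 - t\<^sup>2))) (at t)"
      by (simp add: has_real_derivative_iff_has_vector_derivative)
  qed (auto intro!: continuous_intros)
  then have "((\<lambda>t. 1 / (pi * sqrt (1 - t\<^sup>2))) has_integral 1) {-1..1}"
    by simp
  moreover have "1 / (pi * sqrt (1 - t\<^sup>2)) = cheb_weight t * cos (m * arccos t)" if "t \<in> {-1..1}" for t
    using that True by (simp add: cheb_weight_def)
  ultimately show ?thesis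
    using True has_integral_eq[of "{-1..1}"] by (smt (verit, ccfv_SIG))
next
  case False
  let ?F = "\<lambda>t. - sin (m * arccos t) / (m * pi)"
  have "((\<lambda>t. cheb_weight t * cos (m * arccos t)) has_integral (?F 1 - ?F (-1))) {-1..1}"
  proof (rule fundamental_theorem_of_calculus_interior)
    fix t :: real
    assume t: "t \<in> {-1<..<1}"
    then have "DERIV ?F t :> 1 / (pi * sqrt (1 - t\<^sup>2)) * cos (m * arccos t)"
      using False by (auto intro!: derivative_eq_intros simp: field_simps)
    with t show "(?F has_vector_derivative cheb_weight t * cos (m * arccos t)) (at t)"
      by (simp add: has_real_derivative_iff_has_vector_derivative cheb_weight_def)
  qed (auto intro!: continuous_intros simp: False)
  moreover have "sin (m * pi) = 0"
    by (metis mult.commute sin_npi_int)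
  ultimately show ?thesis
    using False by simp
qed

lemma integrable_cheb_weight: "integrable lborel cheb_weight"
proof -
  have "(cheb_weight has_integral 1) {-1..1}"
    using has_integral_cheb_weight_cos[of 0] by simp
  then have "(\<integral>\<^sup>+ t. ennreal (cheb_weight t) * indicator {-1..1} t \<partial>lborel) = ennreal 1"
    by (intro nn_integral_has_integral_lebesgue' cheb_weight_nonneg)
  moreover have "ennreal (cheb_weight t) * indicator {-1..1} t = ennreal (cheb_weight t)" for t
    by (auto simp: cheb_weight_def indicator_def)
  ultimately show ?thesis
    by (intro integrableI_nonneg) (auto simp: cheb_weight_nonneg)
qed

lemma integrable_cheb_weight_poly: "integrable lborel (\<lambda>t. cheb_weight t * poly p t)"
proof -
  have "compact (poly p ` {-1..1})"
    by (intro compact_continuous_image continuous_intros) auto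
  then have "bounded (poly p ` {-1..1})"
    by (rule compact_imp_bounded)
  then obtain B where B: "\<And>t. t \<in> {-1..1} \<Longrightarrow> \<bar>poly p t\<bar> \<le> B"
    unfolding bounded_iff real_norm_def by blast
  have [measurable]: "poly p \<in> borel_measurable borel"
    by (intro borel_measurable_continuous_onI continuous_intros)
  have "norm (cheb_weight t * poly p t) \<le> norm (B * cheb_weight t)" for t
  proof (cases "t \<in> {-1..1}")
    case True
    then have "cheb_weight t * \<bar>poly p t\<bar> \<le> cheb_weight t * B"
      by (intro mult_left_mono B cheb_weight_nonneg)
    also have "\<dots> \<le> \<bar>B * cheb_weight t\<bar>"
      by (simp add: mult.commute)
    finally show ?thesis
      using cheb_weight_nonneg[of t] by (simp add: abs_mult)
  qed (simp add: cheb_weight_def)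
  then show ?thesis
    by (intro Bochner_Integration.integrable_bound[OF integrable_mult_right[OF integrable_cheb_weight, of B]])
       auto
qed

text \<open>The weight vanishes off the interval, so the gauge integral there is one over the whole
  line; integrability identifies it with the Lebesgue integral.\<close>

lemma integral_cheb_weight_poly:
  assumes "((\<lambda>t. cheb_weight t * poly p t) has_integral c) {-1..1}"
  shows "(LINT t|lborel. cheb_weight t * poly p t) = c"
proof -
  have "(\<lambda>t. cheb_weight t * poly p t) = (\<lambda>t. if t \<in> {-1..1} then cheb_weight t * poly p t else 0)"
    by (auto simp: cheb_weight_def)
  with assms have "((\<lambda>t. cheb_weight t * poly p t) has_integral c) UNIV"
    using has_integral_restrict_UNIV by metis
  then show ?thesis
    using has_integral_integral_lborel[OF integrable_cheb_weight_poly] has_integral_unique by blast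
qed

text \<open>The product-to-sum formula leaves cosines of frequencies j - k and j + k, both nonzero
  for distinct naturals, and each integrates to 0.\<close>

lemma cheb_poly_orthogonal:
  assumes "j \<noteq> k"
  shows "(LINT t|lborel. cheb_weight t * poly (cheb_poly j * cheb_poly k) t) = 0"
proof (rule integral_cheb_weight_poly)
  let ?c = "\<lambda>m :: int. \<lambda>t. cheb_weight t * cos (m * arccos t)"
  have "((\<lambda>t. (?c (int j - int k) t + ?c (int j + int k) t) / 2) has_integral (0 + 0) / 2) {-1..1}"
    using has_integral_cheb_weight_cos[of "int j - int k"] has_integral_cheb_weight_cos[of "int j + int k"]
      assms by (intro has_integral_divide has_integral_add) (auto split: if_splits)
  then show "((\<lambda>t. cheb_weight t * poly (cheb_poly j * cheb_poly k) t) has_integral 0) {-1..1}"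
    by (subst has_integral_cong[of _ _ "\<lambda>t. (?c (int j - int k) t + ?c (int j + int k) t) / 2"])
       (auto simp: poly_cheb_poly cos_times_cos algebra_simps add_divide_distrib)
qed

lemma integral_cheb_weight: "(LINT t|lborel. cheb_weight t) = 1"
  using integral_cheb_weight_poly[of 1 1] has_integral_cheb_weight_cos[of 0] by simp

section \<open>From the interval to the cube\<close>

lemma prod_cheb_weight:
  fixes x :: "real^'n"
  shows "(\<Prod>i\<in>UNIV. cheb_weight (x $ i)) =
    indicator cube x * (\<Prod>i\<in>UNIV. 1 / (pi * sqrt (1 - (x $ i)\<^sup>2)))"
proof (cases "x \<in> cube")
  case False
  then obtain i where "x $ i \<notin> {-1..1}"
    by (auto simp: cube_def)
  then have "cheb_weight (x $ i) = 0"
    by (simp add: cheb_weight_def)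
  with False show ?thesis
    by (metis UNIV_I finite indicator_simps(2) mult_zero_left prod_zero)
qed (simp add: cube_def cheb_weight_def)

text \<open>Fubini for functions that split over the coordinates. \<open>lborel\<close> is an image
  of a product measure indexed by \<open>Basis\<close>, so \<open>e\<close> and \<open>H\<close>
  carry the factors from coordinates to basis vectors.\<close>

lemma
  fixes h :: "'n::finite \<Rightarrow> real \<Rightarrow> real"
  assumes "\<And>i. integrable lborel (h i)"
  shows integrable_lborel_prod_cart: "integrable lborel (\<lambda>x :: real^'n. \<Prod>i\<in>UNIV. h i (x $ i))" (is ?I)
    and integral_lborel_prod_cart:
      "(LINT x|lborel. (\<Prod>i\<in>UNIV. h i ((x :: real^'n) $ i))) = (\<Prod>i\<in>UNIV. (LINT t|lborel. h i t))" (is ?E)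
proof -
  interpret product_sigma_finite "\<lambda>_ :: real^'n. lborel :: real measure"
    by (rule product_sigma_finite.intro) (rule sigma_finite_lborel)
  define e where "e i = (axis i 1 :: real^'n)" for i
  have e: "bij_betw e UNIV Basis"
    by (auto simp: bij_betw_def inj_on_def e_def Basis_vec_def axis_eq_axis)
  define H where "H b = h (the_inv_into UNIV e b)" for b
  have He: "H (e i) = h i" for i
    using e by (simp add: H_def the_inv_into_f_f bij_betw_def)
  have H: "integrable lborel (H b)" for b
    unfolding H_def by (rule assms)
  have [measurable]: "h i \<in> borel_measurable borel" for i
    using borel_measurable_integrable[OF assms[of i]] by simp
  have meas: "(\<lambda>x :: real^'n. \<Prod>i\<in>UNIV. h i (x $ i)) \<in> borel_measurable borel"
    by measurable
  have meas2: "(\<lambda>f. \<Sum>b\<in>Basis. f b *\<^sub>R b) \<in> measurable (\<Pi>\<^sub>M b\<in>Basis. lborel) (borel :: (real^'n) measure)"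
    by measurable
  have "(\<Sum>b\<in>Basis. f b *\<^sub>R b) $ i = f (e i)" for f :: "real^'n \<Rightarrow> real" and i
  proof -
    have "(\<Sum>b\<in>Basis. f b *\<^sub>R b) $ i = (\<Sum>b\<in>Basis. f b *\<^sub>R b) \<bullet> e i"
      by (simp add: e_def inner_axis)
    also have "\<dots> = f (e i)"
      by (intro inner_sum_left_Basis) (simp add: e_def axis_in_Basis_iff)
    finally show ?thesis .
  qed
  then have eq: "(\<Prod>i\<in>UNIV. h i ((\<Sum>b\<in>Basis. f b *\<^sub>R b) $ i)) = (\<Prod>b\<in>Basis. H b (f b))" for f :: "real^'n \<Rightarrow> real"
    by (simp add: prod.reindex_bij_betw[OF e, symmetric] He)
  show ?I
    by (subst lborel_eq, subst integrable_distr_eq[OF meas2 meas], unfold eq)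
       (intro product_integrable_prod H finite_Basis)
  have "(LINT x|lborel. (\<Prod>i\<in>UNIV. h i ((x :: real^'n) $ i))) = (\<Prod>b\<in>Basis. (LINT t|lborel. H b t))"
    by (subst lborel_eq, subst integral_distr[OF meas2 meas], unfold eq)
       (intro product_integral_prod H finite_Basis)
  also have "\<dots> = (\<Prod>i\<in>UNIV. (LINT t|lborel. h i t))"
    by (simp add: prod.reindex_bij_betw[OF e, symmetric] He)
  finally show ?E .
qed

lemma sets_cheb_measure [measurable_cong, simp]:
  "sets (cheb_measure :: (real^'n) measure) = sets (restrict_space borel cube)"
  unfolding cheb_measure_def by (simp cong: sets_restrict_space_cong)

lemma space_cheb_measure [simp]: "space (cheb_measure :: (real^'n) measure) = cube"
  by (simp add: cheb_measure_def space_restrict_space)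

lemma
  fixes F :: "real^'n \<Rightarrow> real"
  assumes F: "F \<in> borel_measurable borel"
  shows integrable_cheb_measure_iff:
      "integrable cheb_measure F \<longleftrightarrow> integrable lborel (\<lambda>x. (\<Prod>i\<in>UNIV. cheb_weight (x $ i)) * F x)" (is ?I)
    and integral_cheb_measure:
      "(LINT x|cheb_measure. F x) = (LINT x|lborel. (\<Prod>i\<in>UNIV. cheb_weight (x $ i)) * F x)" (is ?E)
proof -
  let ?w = "\<lambda>x :: real^'n. \<Prod>i\<in>UNIV. 1 / (pi * sqrt (1 - (x $ i)\<^sup>2))"
  let ?R = "restrict_space lborel (cube :: (real^'n) set)"
  have cube: "(cube :: (real^'n) set) \<inter> space lborel \<in> sets lborel"
    by (simp add: cube_eq_cbox)
  have w: "?w \<in> borel_measurable ?R"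
    by (intro measurable_restrict_space1) simp
  have F': "F \<in> borel_measurable ?R"
    by (intro measurable_restrict_space1) (simp add: F)
  have nonneg: "AE x in ?R. 0 \<le> ?w x"
    by (intro AE_I2 prod_nonneg) (auto simp: space_restrict_space cube_def abs_square_le_1 abs_le_iff)
  show ?I
    unfolding cheb_measure_def
    by (subst integrable_density[OF F' w nonneg], subst integrable_restrict_space[OF cube])
       (simp add: prod_cheb_weight mult.assoc)
  show ?E
    unfolding cheb_measure_def
    by (subst integral_density[OF F' w nonneg], subst integral_restrict_space[OF cube])
       (simp add: prod_cheb_weight mult.assoc)
qed

lemma integrable_cheb_measure_prod_poly:
  "integrable cheb_measure (\<lambda>x :: real^'n. \<Prod>i\<in>UNIV. poly (p i) (x $ i))" (is ?I)
  and integral_cheb_measure_prod_poly: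
  "(LINT x|cheb_measure. (\<Prod>i\<in>UNIV. poly (p i) ((x :: real^'n) $ i))) =
    (\<Prod>i\<in>UNIV. (LINT t|lborel. cheb_weight t * poly (p i) t))" (is ?E)
proof -
  have meas: "(\<lambda>x :: real^'n. \<Prod>i\<in>UNIV. poly (p i) (x $ i)) \<in> borel_measurable borel"
    by (intro borel_measurable_continuous_onI continuous_intros)
  show ?I
    unfolding integrable_cheb_measure_iff[OF meas] prod.distrib[symmetric]
    by (intro integrable_lborel_prod_cart integrable_cheb_weight_poly)
  show ?E
    unfolding integral_cheb_measure[OF meas] prod.distrib[symmetric]
    by (intro integral_lborel_prod_cart integrable_cheb_weight_poly)
qed

lemma integral_cheb_measure_one: "(LINT x|(cheb_measure :: (real^'n) measure). (1 :: real)) = 1"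
  using integral_cheb_measure_prod_poly[where p = "\<lambda>_. 1" and 'n = 'n] by (simp add: integral_cheb_weight)

lemma finite_measure_cheb_measure: "finite_measure (cheb_measure :: (real^'n) measure)"
proof
  have "integrable (cheb_measure :: (real^'n) measure) (\<lambda>_. 1 :: real)"
    using integrable_cheb_measure_prod_poly[where p = "\<lambda>_. 1" and 'n = 'n] by simp
  \<comment> \<open>The space of the measure is the cube, where the constant 1 and the indicator
    agree.\<close>
  then have "integrable (cheb_measure :: (real^'n) measure) (indicator cube :: _ \<Rightarrow> real)"
    by (rule Bochner_Integration.integrable_cong[THEN iffD1, rotated 2]) auto
  then show "emeasure (cheb_measure :: (real^'n) measure) (space cheb_measure) \<noteq> \<infinity>"
    by (subst (asm) integrable_indicator_iff) auto
qed

lemma borel_measurable_cheb_measure: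
  fixes F :: "real^'n \<Rightarrow> real"
  assumes "continuous_on cube F"
  shows "F \<in> borel_measurable cheb_measure"
  using borel_measurable_continuous_on_restrict[OF assms]
  by (simp cong: measurable_cong_sets)

lemma integrable_cheb_measure:
  fixes F :: "real^'n \<Rightarrow> real"
  assumes "continuous_on cube F"
  shows "integrable cheb_measure F"
proof -
  interpret finite_measure "cheb_measure :: (real^'n) measure"
    by (rule finite_measure_cheb_measure)
  have "bounded (F ` cube)"
    using assms by (intro compact_imp_bounded compact_continuous_image) (auto simp: cube_eq_cbox)
  then obtain B where "\<And>x. x \<in> cube \<Longrightarrow> norm (F x) \<le> B"
    by (auto simp: bounded_iff)
  then show ?thesis
    by (intro integrable_const_bound[of _ B] AE_I2 borel_measurable_cheb_measure assms) auto
qed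

section \<open>Multivariate Chebyshev polynomials\<close>

lemma continuous_on_cheb [continuous_intros]:
  "continuous_on S g \<Longrightarrow> continuous_on S (\<lambda>x. cheb \<alpha> (g x))"
  unfolding cheb_def by (intro continuous_intros)

text \<open>The integral factors over the coordinates, and a coordinate in which the indices differ
  contributes a factor 0.\<close>

lemma cheb_orthogonal:
  fixes \<alpha> \<beta> :: "nat^'n"
  assumes "\<alpha> \<noteq> \<beta>"
  shows "(LINT x|cheb_measure. cheb \<alpha> x * cheb \<beta> x) = 0"
proof -
  obtain i where "\<alpha> $ i \<noteq> \<beta> $ i"
    using assms by (auto simp: vec_eq_iff)
  then have "(\<Prod>i\<in>UNIV. (LINT t|lborel. cheb_weight t * poly (cheb_poly (\<alpha> $ i) * cheb_poly (\<beta> $ i)) t)) = 0"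
    by (intro prod_zero bexI[of _ i] cheb_poly_orthogonal) auto
  then show ?thesis
    unfolding integral_cheb_measure_prod_poly[symmetric]
    by (simp add: cheb_def prod.distrib)
qed

lemma cheb_0: "cheb 0 x = 1"
  by (simp add: cheb_def)

lemma cheb_axis: "cheb (axis i m) x = poly (cheb_poly m) (x $ i)"
proof -
  have "cheb (axis i m) x = (\<Prod>j\<in>UNIV. if j = i then poly (cheb_poly m) (x $ j) else 1)"
    unfolding cheb_def by (intro prod.cong) (auto simp: axis_def)
  then show ?thesis
    by simp
qed

lemma cheb_axis_1: "cheb (axis i 1) x = x $ i"
  by (simp add: cheb_axis)

lemma cheb_axis_2: "cheb (axis i 2) x = 2 * (x $ i)\<^sup>2 - 1"
  by (simp add: cheb_axis numeral_2_eq_2 power2_eq_square)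

lemma cheb_at_one: "cheb \<alpha> 1 = 1"
proof -
  have "poly (cheb_poly k) 1 = 1" for k
    by (induction k rule: cheb_poly.induct) auto
  then show ?thesis
    by (simp add: cheb_def)
qed

text \<open>The polynomial \<open>cheb (axis i 2)\<close>, that is 2 t^2 - 1 in the coordinate t, is
  orthogonal to the constant \<open>cheb 0\<close>.\<close>

lemma integral_cheb_measure_square:
  "(LINT x|cheb_measure. ((x :: real^'n) $ i)\<^sup>2) = 1 / 2"
proof -
  have "axis i 2 \<noteq> (0 :: nat^'n)"
    by (simp add: axis_eq_0_iff)
  then have "(LINT x|cheb_measure. cheb (axis i 2) (x :: real^'n) * cheb 0 x) = 0"
    by (rule cheb_orthogonal)
  then have "(LINT x|cheb_measure. 2 * ((x :: real^'n) $ i)\<^sup>2 - 1) = 0"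
    by (simp add: cheb_0 cheb_axis_2)
  moreover have "(LINT x|cheb_measure. 2 * ((x :: real^'n) $ i)\<^sup>2 - 1) =
      2 * (LINT x|cheb_measure. ((x :: real^'n) $ i)\<^sup>2) - 1"
    by (subst Bochner_Integration.integral_diff)
      (auto intro!: integrable_cheb_measure continuous_intros simp: integral_cheb_measure_one[simplified])
  ultimately show ?thesis
    by simp
qed

section \<open>Second moments of Chebyshev kernels\<close>

text \<open>One kernel at a fixed degree. Its values are constrained only on the cube, so arguments
  that need global regularity must pass to the polynomial expansion.\<close>

locale chebyshev_kernel =
  fixes k :: "real^'n \<Rightarrow> real^'n \<Rightarrow> real" and g :: "nat^'n \<Rightarrow> real" and I :: "(nat^'n) set"
  assumes finite_I: "finite I"
    and expansion: "x \<in> cube \<Longrightarrow> y \<in> cube \<Longrightarrow> k x y = (\<Sum>\<alpha>\<in>I. g \<alpha> * cheb \<alpha> x * cheb \<alpha> y)"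
    and nonneg: "x \<in> cube \<Longrightarrow> y \<in> cube \<Longrightarrow> 0 \<le> k x y"
    and normalized: "x \<in> cube \<Longrightarrow> (LINT y|cheb_measure. k x y) = 1"
begin

lemma one_in_cube: "1 \<in> (cube :: (real^'n) set)"
  by (simp add: cube_def)

lemma continuous_on_kernel: "x \<in> cube \<Longrightarrow> continuous_on cube (k x)"
  by (subst continuous_on_cong[OF refl expansion]) (auto intro!: continuous_intros)

lemma integrable_kernel: "x \<in> cube \<Longrightarrow> continuous_on cube F \<Longrightarrow> integrable cheb_measure (\<lambda>y. F y * k x y)"
  by (intro integrable_cheb_measure continuous_on_mult continuous_on_kernel)

lemma integral_kernel_mono:
  assumes "x \<in> cube" "continuous_on cube F" "continuous_on cube G" "\<And>y. y \<in> cube \<Longrightarrow> F y \<le> G y"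
  shows "(LINT y|cheb_measure. F y * k x y) \<le> (LINT y|cheb_measure. G y * k x y)"
  by (intro integral_mono integrable_kernel assms mult_right_mono nonneg)
     (use assms in auto)

text \<open>By orthogonality \<^term>\<open>cheb \<alpha>\<close> is an eigenfunction of the convolution operator; since
  \<^term>\<open>cheb \<alpha> 1 = 1\<close>, its eigenvalue is the value of the convolution at \<^term>\<open>1\<close>.\<close>

lemma cheb_eigenfunction:
  assumes x: "x \<in> cube"
  shows "(LINT y|cheb_measure. cheb \<alpha> y * k x y) = cheb \<alpha> x * (LINT y|cheb_measure. cheb \<alpha> y * k 1 y)"
proof -
  define N where "N = (LINT y|cheb_measure. cheb \<alpha> y * cheb \<alpha> (y :: real^'n))"
  have *: "(LINT y|cheb_measure. cheb \<alpha> y * k x y) = cheb \<alpha> x * (if \<alpha> \<in> I then g \<alpha> * N else 0)"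
    if x: "x \<in> cube" for x
  proof -
    have "(LINT y|cheb_measure. cheb \<alpha> y * k x y) =
        (LINT y|cheb_measure. (\<Sum>\<beta>\<in>I. g \<beta> * cheb \<beta> x * (cheb \<alpha> y * cheb \<beta> y)))"
      by (intro Bochner_Integration.integral_cong)
         (auto simp: expansion x sum_distrib_left mult_ac)
    also have "\<dots> = (\<Sum>\<beta>\<in>I. g \<beta> * cheb \<beta> x * (LINT y|cheb_measure. cheb \<alpha> y * cheb \<beta> y))"
      by (subst Bochner_Integration.integral_sum)
         (auto intro!: integrable_cheb_measure continuous_intros)
    also have "\<dots> = (\<Sum>\<beta>\<in>I. if \<beta> = \<alpha> then g \<alpha> * cheb \<alpha> x * N else 0)"
      by (intro sum.cong refl) (auto simp: N_def cheb_orthogonal)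
    finally show ?thesis
      by (simp add: finite_I)
  qed
  show ?thesis
    using *[OF x] *[OF one_in_cube] by (simp add: cheb_at_one)
qed

text \<open>\<open>mean i\<close> is the eigenvalue belonging to \<open>cheb (axis i 1)\<close>;
  with \<open>mean_square\<close> below, \<open>2 * mean_square i - 1\<close> is the one belonging
  to \<open>cheb (axis i 2)\<close>.\<close>

definition mean :: "'n \<Rightarrow> real" where
  "mean i = (LINT y|cheb_measure. y $ i * k 1 y)"

definition mean_square :: "'n \<Rightarrow> real" where
  "mean_square i = (LINT y|cheb_measure. (y $ i)\<^sup>2 * k 1 y)"

lemma integral_kernel_coordinate:
  assumes "x \<in> cube"
  shows "(LINT y|cheb_measure. y $ i * k x y) = x $ i * mean i"
  using cheb_eigenfunction[OF assms, of "axis i 1"] unfolding cheb_axis_1 mean_def .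

lemma integral_kernel_cheb_axis_2:
  assumes "x \<in> cube"
  shows "(LINT y|cheb_measure. cheb (axis i 2) y * k x y) = 2 * (LINT y|cheb_measure. (y $ i)\<^sup>2 * k x y) - 1"
proof -
  have "(LINT y|cheb_measure. cheb (axis i 2) y * k x y) =
      (LINT y|cheb_measure. 2 * ((y $ i)\<^sup>2 * k x y) - 1 * k x y)"
    by (simp add: cheb_axis_2 algebra_simps)
  also have "\<dots> = 2 * (LINT y|cheb_measure. (y $ i)\<^sup>2 * k x y) - 1"
    using normalized[OF assms]
    by (subst Bochner_Integration.integral_diff[OF integrable_mult_right[OF integrable_kernel] integrable_kernel])
       (auto intro!: assms continuous_intros)
  finally show ?thesis .
qed

text \<open>The eigenvalue relation for 2 t^2 - 1, solved for the integral of the square.\<close>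

lemma integral_kernel_coordinate_square:
  assumes "x \<in> cube"
  shows "(LINT y|cheb_measure. (y $ i)\<^sup>2 * k x y) = (1 + (2 * (x $ i)\<^sup>2 - 1) * (2 * mean_square i - 1)) / 2"
  using cheb_eigenfunction[OF assms, of "axis i 2"]
  unfolding integral_kernel_cheb_axis_2[OF assms] integral_kernel_cheb_axis_2[OF one_in_cube]
  unfolding cheb_axis_2 mean_square_def by simp

lemma integral_kernel_quadratic:
  assumes "x \<in> cube"
  shows "(LINT y|cheb_measure. (c - y $ i)\<^sup>2 * k x y) =
    c\<^sup>2 - 2 * c * (LINT y|cheb_measure. y $ i * k x y) + (LINT y|cheb_measure. (y $ i)\<^sup>2 * k x y)"
proof -
  have int: "integrable cheb_measure (\<lambda>y. y $ i * k x y)" "integrable cheb_measure (\<lambda>y. (y $ i)\<^sup>2 * k x y)"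
    "integrable cheb_measure (k x)"
    using integrable_kernel[OF assms, of "\<lambda>_. 1"] by (auto intro!: integrable_kernel assms continuous_intros)
  have "(LINT y|cheb_measure. (c - y $ i)\<^sup>2 * k x y) =
      (LINT y|cheb_measure. c\<^sup>2 * k x y - 2 * c * (y $ i * k x y) + (y $ i)\<^sup>2 * k x y)"
    by (simp add: power2_diff algebra_simps)
  also have "\<dots> = c\<^sup>2 - 2 * c * (LINT y|cheb_measure. y $ i * k x y) + (LINT y|cheb_measure. (y $ i)\<^sup>2 * k x y)"
    using int normalized[OF assms] by simp
  finally show ?thesis .
qed

lemma mean_square_le_1: "mean_square i \<le> 1"
proof -
  have "mean_square i \<le> (LINT y|cheb_measure. 1 * k 1 y)"
    unfolding mean_square_def
    by (intro integral_kernel_mono one_in_cube continuous_intros)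
       (auto simp: cube_def abs_square_le_1 abs_le_iff)
  then show ?thesis
    using normalized[OF one_in_cube] by simp
qed

text \<open>The right-hand side is the second moment about 1 of coordinate \<open>i\<close> under
  the density \<open>k 1\<close>. This and \<open>mean_square_le_1\<close> are the endpoint cases of
  the comparison in \<open>second_moment_le\<close>.\<close>

lemma mean_mean_square: "0 \<le> 1 - 2 * mean i + mean_square i"
proof -
  have "0 \<le> (LINT y|cheb_measure. (1 - y $ i)\<^sup>2 * k 1 y)"
    by (intro integral_nonneg_AE AE_I2 mult_nonneg_nonneg nonneg one_in_cube) auto
  then show ?thesis
    unfolding integral_kernel_quadratic[OF one_in_cube] by (simp add: mean_def mean_square_def)
qed

definition second_moment :: "real^'n \<Rightarrow> real" where
  "second_moment x = (LINT y|cheb_measure. (norm (x - y))\<^sup>2 * k x y)"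

lemma second_moment_eq:
  assumes "x \<in> cube"
  shows "second_moment x =
    (\<Sum>i\<in>UNIV. 2 * (x $ i)\<^sup>2 * (mean_square i - mean i) + 1 - mean_square i)"
proof -
  have "(norm (x - y))\<^sup>2 = (\<Sum>i\<in>UNIV. (x $ i - y $ i)\<^sup>2)" for y :: "real^'n"
    unfolding power2_norm_eq_inner inner_vec_def by (simp add: power2_eq_square)
  then have "second_moment x = (\<Sum>i\<in>UNIV. (LINT y|cheb_measure. (x $ i - y $ i)\<^sup>2 * k x y))"
    unfolding second_moment_def
    by (simp add: sum_distrib_right, subst Bochner_Integration.integral_sum)
       (auto intro!: integrable_kernel assms continuous_intros)
  also have "\<dots> = (\<Sum>i\<in>UNIV. 2 * (x $ i)\<^sup>2 * (mean_square i - mean i) + 1 - mean_square i)"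
    unfolding integral_kernel_quadratic[OF assms] integral_kernel_coordinate[OF assms]
      integral_kernel_coordinate_square[OF assms]
    by (intro sum.cong refl) (simp add: field_simps power2_eq_square)
  finally show ?thesis .
qed

section \<open>The resolution as an average of second moments\<close>

lemma integrable_pair_kernel:
  "integrable (cheb_measure \<Otimes>\<^sub>M cheb_measure) (\<lambda>z. (norm (fst z - snd z))\<^sup>2 * k (fst z) (snd z))"
proof -
  let ?M = "cheb_measure \<Otimes>\<^sub>M cheb_measure :: ((real^'n) \<times> (real^'n)) measure"
  \<comment> \<open>\<open>P\<close> equals the integrand on the product of the cubes and is
    continuous everywhere, which settles measurability on the product space.\<close>
  define P :: "(real^'n) \<times> (real^'n) \<Rightarrow> real"
    where "P z = (norm (fst z - snd z))\<^sup>2 * (\<Sum>\<alpha>\<in>I. g \<alpha> * cheb \<alpha> (fst z) * cheb \<alpha> (snd z))" for z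
  interpret finite_measure ?M
    by (intro finite_measure_pair_measure finite_measure_cheb_measure)
  have cont: "continuous_on S P" for S
    unfolding P_def by (intro continuous_intros)
  have "bounded (P ` (cube \<times> cube))"
    unfolding cube_eq_cbox by (intro compact_imp_bounded compact_continuous_image cont compact_Times compact_cbox)
  then obtain B where B: "\<And>z. z \<in> cube \<times> cube \<Longrightarrow> norm (P z) \<le> B"
    unfolding bounded_iff by blast
  have id: "(\<lambda>x. x) \<in> measurable (cheb_measure :: (real^'n) measure) borel"
    by (simp add: measurable_restrict_space1 cong: measurable_cong_sets)
  have "(\<lambda>z. (fst z, snd z)) \<in> measurable ?M (borel \<Otimes>\<^sub>M borel)"
    by (intro measurable_Pair measurable_compose[OF measurable_fst id] measurable_compose[OF measurable_snd id])
  then have "P \<in> borel_measurable ?M"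
    using borel_measurable_continuous_onI[OF cont[of UNIV]] measurable_compose
    unfolding borel_prod by fastforce
  then have "integrable ?M P"
    using B by (intro integrable_const_bound[of _ B] AE_I2) (auto simp: space_pair_measure)
  then show ?thesis
    by (rule Bochner_Integration.integrable_cong[THEN iffD1, rotated 2])
       (auto simp: P_def expansion space_pair_measure)
qed

lemma resolution_nonneg: "0 \<le> resolution k"
proof -
  have "0 \<le> (LINT z|(cheb_measure \<Otimes>\<^sub>M cheb_measure). (norm (fst z - snd z))\<^sup>2 * k (fst z) (snd z))"
    by (intro integral_nonneg_AE AE_I2) (auto intro!: mult_nonneg_nonneg nonneg simp: space_pair_measure)
  then show ?thesis
    by (simp add: resolution_def)
qed

text \<open>By Fubini this is the integral of \<open>second_moment\<close>. Each squared coordinate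
  averages to 1/2, so the \<open>mean_square\<close> terms cancel.\<close>

lemma resolution_square: "(resolution k)\<^sup>2 = (\<Sum>i\<in>UNIV. 1 - mean i)"
proof -
  interpret finite_measure "cheb_measure :: (real^'n) measure"
    by (rule finite_measure_cheb_measure)
  interpret pair_sigma_finite "cheb_measure :: (real^'n) measure" "cheb_measure :: (real^'n) measure"
    ..
  \<comment> \<open>Constants keep the shape \<open>c * 1\<close> so that rewriting can pull out
    \<open>c\<close> and apply \<open>integral_cheb_measure_one\<close>.\<close>
  have int: "integrable cheb_measure (\<lambda>x. a * (x $ i)\<^sup>2)" "integrable cheb_measure (\<lambda>x. c * 1)"
    "integrable cheb_measure (\<lambda>x. a * (x $ i)\<^sup>2 + c * 1)" for a c :: real and i :: 'n
    by (intro integrable_cheb_measure continuous_intros)+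
  have "(LINT z|(cheb_measure \<Otimes>\<^sub>M cheb_measure). (norm (fst z - snd z))\<^sup>2 * k (fst z) (snd z)) =
      (LINT x|cheb_measure. second_moment x)"
    using integral_fst'[OF integrable_pair_kernel] by (simp add: second_moment_def)
  also have "\<dots> = (LINT x|cheb_measure. (\<Sum>i\<in>UNIV. 2 * (mean_square i - mean i) * (x $ i)\<^sup>2 + (1 - mean_square i) * 1))"
    by (intro Bochner_Integration.integral_cong) (auto simp: second_moment_eq algebra_simps)
  also have "\<dots> = (\<Sum>i\<in>UNIV. 2 * (mean_square i - mean i) * (1 / 2) + (1 - mean_square i) * 1)"
    by (simp only: int Bochner_Integration.integral_sum Bochner_Integration.integral_add
        integral_mult_right_zero integral_cheb_measure_square integral_cheb_measure_one)
  also have "\<dots> = (\<Sum>i\<in>UNIV. 1 - mean i)"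
    by (intro sum.cong) (auto simp: field_simps)
  finally have "(LINT z|(cheb_measure \<Otimes>\<^sub>M cheb_measure). (norm (fst z - snd z))\<^sup>2 * k (fst z) (snd z)) =
      (\<Sum>i\<in>UNIV. 1 - mean i)" .
  \<comment> \<open>\<open>sqrt\<close> preserves signs, so \<open>resolution_nonneg\<close> makes
    the integral nonnegative and squaring undoes the root.\<close>
  then show ?thesis
    using resolution_nonneg by (simp add: resolution_def)
qed

text \<open>Each summand of the second moment is affine in the square of the coordinate, so it suffices
  to compare at the values 0 and 1 of that square.\<close>

lemma second_moment_le:
  assumes "x \<in> cube"
  shows "second_moment x \<le> 2 * (resolution k)\<^sup>2"
  unfolding second_moment_eq[OF assms] resolution_square sum_distrib_left
proof (rule sum_mono)
  fix i
  define s where "s = (x $ i)\<^sup>2"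
  have s: "0 \<le> s" "s \<le> 1"
    using assms by (auto simp: s_def cube_def abs_square_le_1 abs_le_iff)
  have "0 \<le> s * (1 - mean_square i) + (1 - s) * (1 - 2 * mean i + mean_square i)"
    using s mean_square_le_1[of i] mean_mean_square[of i]
    by (intro add_nonneg_nonneg[OF mult_nonneg_nonneg mult_nonneg_nonneg]) auto
  then show "2 * (x $ i)\<^sup>2 * (mean_square i - mean i) + 1 - mean_square i \<le> 2 * (1 - mean i)"
    unfolding s_def[symmetric] by (simp add: algebra_simps)
qed

end

section \<open>Comparison with the modulus of continuity\<close>

lemma modulus_of_continuity_ge:
  assumes "continuous_on cube f" "0 \<le> \<delta>" "x \<in> cube" "y \<in> cube" "norm (x - y) \<le> \<delta>"
  shows "\<bar>f x - f y\<bar> \<le> modulus_of_continuity f \<delta>"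
  using modulus_of_continuity_attained[OF assms(1,2)] assms(3-5) by metis

lemma modulus_of_continuity_nonneg:
  assumes "continuous_on (cube :: (real^'n) set) f" "0 \<le> \<delta>"
  shows "0 \<le> modulus_of_continuity f \<delta>"
  using modulus_of_continuity_ge[OF assms, of 0 0] assms(2) by (simp add: cube_def)

text \<open>Uniform continuity on the compact cube, applied to a pair that attains the modulus. The
  radius is halved because the modulus admits pairs at distance exactly \<open>d\<close>.\<close>

lemma modulus_of_continuity_le_arbitrary:
  fixes f :: "real^'n \<Rightarrow> real"
  assumes f: "continuous_on cube f" and "0 < e"
  obtains d where "0 < d" "modulus_of_continuity f d \<le> e"
proof -
  have "uniformly_continuous_on cube f"
    using f by (intro compact_uniformly_continuous) (auto simp: cube_eq_cbox)
  then obtain d where d: "0 < d"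
    "\<And>x y. x \<in> cube \<Longrightarrow> y \<in> cube \<Longrightarrow> dist y x < d \<Longrightarrow> dist (f y) (f x) < e"
    using \<open>0 < e\<close> unfolding uniformly_continuous_on_def by metis
  obtain x y where "x \<in> cube" "y \<in> cube" "norm (x - y) \<le> d / 2"
    "modulus_of_continuity f (d / 2) = \<bar>f x - f y\<bar>"
    using modulus_of_continuity_attained[OF f, of "d / 2"] d(1)
    by (metis half_gt_zero_iff less_eq_real_def)
  then have "modulus_of_continuity f (d / 2) \<le> e"
    using d(1) d(2)[of y x] by (simp add: dist_norm)
  with d(1) show ?thesis
    by (intro that[of "d / 2"]) auto
qed

text \<open>The segment from \<open>x\<close> to \<open>y\<close> stays in the convex cube and is
  cut into \<open>N\<close> equal pieces of length at most \<delta>.\<close>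

lemma modulus_of_continuity_chain:
  assumes f: "continuous_on cube f" and \<delta>: "0 \<le> \<delta>"
    and "x \<in> cube" "y \<in> cube" "norm (x - y) \<le> real N * \<delta>"
  shows "\<bar>f x - f y\<bar> \<le> real N * modulus_of_continuity f \<delta>"
  using assms(3-)
proof (induction N arbitrary: y)
  case (Suc N)
  \<comment> \<open>The last division point: the induction hypothesis covers \<open>x\<close> to
    \<open>z\<close>, and one step remains from \<open>z\<close> to \<open>y\<close>.\<close>
  define z where "z = x + (real N / real (Suc N)) *\<^sub>R (y - x)"
  have z: "z \<in> cube"
  proof -
    have "z = (1 - real N / real (Suc N)) *\<^sub>R x + (real N / real (Suc N)) *\<^sub>R y"
      by (simp add: z_def algebra_simps)
    then show ?thesis
      using Suc.prems(1,2) convex_box(1) unfolding cube_eq_cbox convex_alt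
      by (metis (no_types, opaque_lifting) divide_le_eq_1 divide_nonneg_nonneg lessI nless_le of_nat_0_le_iff of_nat_le_iff)
  qed
  have "x - z = (real N / real (Suc N)) *\<^sub>R (x - y)" "z - y = (1 / real (Suc N)) *\<^sub>R (x - y)"
    by (simp_all add: z_def field_simps vec_eq_iff)
  then have "norm (x - z) = real N * (norm (x - y) / real (Suc N))" "norm (z - y) = norm (x - y) / real (Suc N)"
    by simp_all
  moreover have "norm (x - y) / real (Suc N) \<le> \<delta>"
    using Suc.prems(3) by (simp add: field_simps)
  ultimately have "norm (x - z) \<le> real N * \<delta>" "norm (z - y) \<le> \<delta>"
    by (simp_all only: mult_left_mono of_nat_0_le_iff)
  then have "\<bar>f x - f z\<bar> \<le> real N * modulus_of_continuity f \<delta>" "\<bar>f z - f y\<bar> \<le> modulus_of_continuity f \<delta>"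
    using Suc z by (auto intro: modulus_of_continuity_ge[OF f \<delta>])
  then show ?case
    by (simp add: algebra_simps)
qed simp

text \<open>Rounding t = \<open>norm (x - y) / \<delta>\<close> up gives the number of steps, at
  most 1 if t is at most 1 and otherwise at most 1 + t, hence always at most 1 + t^2. The quadratic
  form is what a second moment can control.\<close>

lemma modulus_of_continuity_quadratic:
  assumes f: "continuous_on cube f" and \<delta>: "0 < \<delta>" and "x \<in> cube" "y \<in> cube"
  shows "\<bar>f x - f y\<bar> \<le> (1 + (norm (x - y))\<^sup>2 / \<delta>\<^sup>2) * modulus_of_continuity f \<delta>"
proof -
  define t where "t = norm (x - y) / \<delta>"
  define N where "N = nat \<lceil>t\<rceil>"
  have t: "0 \<le> t"
    using \<delta> by (simp add: t_def)
  have "t \<le> real N"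
    unfolding N_def by linarith
  then have "norm (x - y) \<le> real N * \<delta>"
    using \<delta> by (simp add: t_def field_simps)
  then have "\<bar>f x - f y\<bar> \<le> real N * modulus_of_continuity f \<delta>"
    using assms by (intro modulus_of_continuity_chain) auto
  also have "real N \<le> 1 + t\<^sup>2"
  proof (cases "t \<le> 1")
    case True
    then have "N \<le> 1"
      by (simp add: N_def ceiling_le_iff)
    then show ?thesis
      by (smt (verit) of_nat_1 of_nat_le_iff zero_le_power2)
  next
    case False
    then have "t * 1 \<le> t * t"
      by (intro mult_left_mono) auto
    moreover have "real N \<le> 1 + t"
      using t unfolding N_def by linarith
    ultimately show ?thesis
      by (simp add: power2_eq_square)
  qed
  finally show ?thesis
    using modulus_of_continuity_nonneg[OF f, of \<delta>] \<delta> by (simp add: t_def power_divide mult_right_mono)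
qed

section \<open>Error of the convolution\<close>

text \<open>As \<open>k x\<close> has integral 1, the error is the integral of (f y - f x)
  \<open>k x y\<close>. The scale \<delta> stays free: uniform convergence fixes it in advance,
  while the rate ties it to the resolution.\<close>

lemma (in chebyshev_kernel) convolution_error_le:
  assumes f: "continuous_on cube f" and x: "x \<in> cube" and \<delta>: "0 < \<delta>"
  shows "\<bar>convolution k f x - f x\<bar> \<le> (1 + 2 * (resolution k)\<^sup>2 / \<delta>\<^sup>2) * modulus_of_continuity f \<delta>"
proof -
  define \<omega> where "\<omega> = modulus_of_continuity f \<delta>"
  have \<omega>: "0 \<le> \<omega>"
    using modulus_of_continuity_nonneg[OF f, of \<delta>] \<delta> by (simp add: \<omega>_def)
  have int: "integrable cheb_measure (\<lambda>y. f y * k x y)" "integrable cheb_measure (k x)"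
    "integrable cheb_measure (\<lambda>y. (norm (x - y))\<^sup>2 * k x y)"
    by (intro integrable_kernel integrable_cheb_measure continuous_on_kernel continuous_intros x f)+
  have "convolution k f x - f x = (LINT y|cheb_measure. f y * k x y - f x * k x y)"
    using int normalized[OF x] by (simp add: convolution_def)
  also have "\<bar>\<dots>\<bar> \<le> (LINT y|cheb_measure. \<bar>f y * k x y - f x * k x y\<bar>)"
    by (rule integral_abs_bound)
  also have "\<dots> \<le> (LINT y|cheb_measure. \<omega> * k x y + \<omega> / \<delta>\<^sup>2 * ((norm (x - y))\<^sup>2 * k x y))"
  proof (intro integral_mono)
    fix y
    assume "y \<in> space (cheb_measure :: (real^'n) measure)"
    then have y: "y \<in> cube"
      by simp
    have "\<bar>f y * k x y - f x * k x y\<bar> = \<bar>f x - f y\<bar> * k x y"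
      using nonneg[OF x y] by (simp add: abs_mult left_diff_distrib[symmetric] abs_minus_commute)
    also have "\<dots> \<le> (1 + (norm (x - y))\<^sup>2 / \<delta>\<^sup>2) * \<omega> * k x y"
      unfolding \<omega>_def by (intro mult_right_mono modulus_of_continuity_quadratic f \<delta> x y nonneg)
    finally show "\<bar>f y * k x y - f x * k x y\<bar> \<le> \<omega> * k x y + \<omega> / \<delta>\<^sup>2 * ((norm (x - y))\<^sup>2 * k x y)"
      by (simp add: algebra_simps)
  qed (use int in auto)
  also have "\<dots> = \<omega> + \<omega> / \<delta>\<^sup>2 * second_moment x"
    using int normalized[OF x] by (simp add: second_moment_def)
  also have "\<dots> \<le> \<omega> + \<omega> / \<delta>\<^sup>2 * (2 * (resolution k)\<^sup>2)"
    using \<omega> by (intro add_left_mono mult_left_mono second_moment_le x) auto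
  finally show ?thesis
    unfolding \<omega>_def by (simp add: algebra_simps)
qed

text \<open>At scale \<open>resolution k\<close> the factor is 1 + 2. A zero resolution is no
  admissible scale, but then the error is at most the modulus at every positive scale, hence
  0.\<close>

lemma (in chebyshev_kernel) convolution_error_le_resolution:
  assumes f: "continuous_on cube f" and x: "x \<in> cube"
  shows "\<bar>convolution k f x - f x\<bar> \<le> 3 * modulus_of_continuity f (resolution k)"
proof (cases "resolution k = 0")
  case True
  have "\<bar>convolution k f x - f x\<bar> \<le> 0 + e" if e: "0 < e" for e
  proof -
    obtain d where "0 < d" "modulus_of_continuity f d \<le> e"
      using modulus_of_continuity_le_arbitrary[OF f e] by blast
    then show ?thesis
      using convolution_error_le[OF f x, of d] True by simp
  qed
  then have "\<bar>convolution k f x - f x\<bar> \<le> 0"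
    by (rule field_le_epsilon)
  then show ?thesis
    using modulus_of_continuity_nonneg[OF f, of 0] True by simp
next
  case False
  moreover have "0 \<le> resolution k"
    by (rule resolution_nonneg)
  ultimately show ?thesis
    using convolution_error_le[OF f x, of "resolution k"] by simp
qed

theorem proposition1:
  fixes f :: "real^'n \<Rightarrow> real" and K :: "nat \<Rightarrow> real^'n \<Rightarrow> real^'n \<Rightarrow> real"
  assumes f: "continuous_on cube f"
    and P1: "\<And>r. \<exists>g. \<forall>x\<in>cube. \<forall>y\<in>cube.
               K r x y = (\<Sum>\<alpha>\<in>multi_indices r. g \<alpha> * cheb \<alpha> x * cheb \<alpha> y)"
    and P2: "\<And>r x y. x \<in> cube \<Longrightarrow> y \<in> cube \<Longrightarrow> K r x y \<ge> 0"
    and P3: "\<And>r x. x \<in> cube \<Longrightarrow> (LINT y|cheb_measure. K r x y) = 1"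
    and P4: "(\<lambda>r. resolution (K r)) \<longlonglongrightarrow> 0"
  shows "uniform_limit cube (\<lambda>r. convolution (K r) f) f sequentially \<and>
         (\<forall>r. sup_norm_cube (\<lambda>x. convolution (K r) f x - f x)
                \<le> 2 * (1 + pi / sqrt 2) * modulus_of_continuity f (resolution (K r)))"
proof (intro conjI allI)
  obtain g where g: "\<And>r x y. x \<in> cube \<Longrightarrow> y \<in> cube \<Longrightarrow>
      K r x y = (\<Sum>\<alpha>\<in>multi_indices r. g r \<alpha> * cheb \<alpha> x * cheb \<alpha> y)"
    using P1 by metis
  have kernel: "chebyshev_kernel (K r) (g r) (multi_indices r)" for r
    by unfold_locales (use g P2 P3 finite_multi_indices in auto)
  show "uniform_limit cube (\<lambda>r. convolution (K r) f) f sequentially"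
  proof (rule uniform_limitI)
    fix e :: real
    assume "0 < e"
    \<comment> \<open>Once the resolution is below \<open>d\<close>, the error factor is at most 3,
      and 3 e / 4 is strictly below \<open>e\<close>.\<close>
    then obtain d where d: "0 < d" "modulus_of_continuity f d \<le> e / 4"
      using modulus_of_continuity_le_arbitrary[OF f, of "e / 4"] by auto
    have "\<forall>\<^sub>F r in sequentially. \<bar>resolution (K r)\<bar> < d"
      using tendstoD[OF P4 d(1)] by simp
    then show "\<forall>\<^sub>F r in sequentially. \<forall>x\<in>cube. dist (convolution (K r) f x) (f x) < e"
    proof eventually_elim
      case (elim r)
      then have "(resolution (K r))\<^sup>2 \<le> d\<^sup>2"
        using d(1) by (simp add: abs_le_square_iff[symmetric])
      then have "1 + 2 * (resolution (K r))\<^sup>2 / d\<^sup>2 \<le> 3"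
        using d(1) by (simp add: field_simps)
      then have "(1 + 2 * (resolution (K r))\<^sup>2 / d\<^sup>2) * modulus_of_continuity f d \<le> 3 * (e / 4)"
        using d \<open>0 < e\<close> modulus_of_continuity_nonneg[OF f, of d] by (intro mult_mono) auto
      then show ?case
        using chebyshev_kernel.convolution_error_le[OF kernel f _ d(1), of _ r] \<open>0 < e\<close>
        by (fastforce simp: dist_real_def)
    qed
  qed
  fix r
  interpret chebyshev_kernel "K r" "g r" "multi_indices r"
    by (rule kernel)
  let ?\<omega> = "modulus_of_continuity f (resolution (K r))"
  \<comment> \<open>The error at a single point is already a nonnegative lower bound.\<close>
  have \<omega>: "0 \<le> 3 * ?\<omega>"
    using convolution_error_le_resolution[OF f one_in_cube] by linarith
  have "sup_norm_cube (\<lambda>x. convolution (K r) f x - f x) \<le> 3 * ?\<omega>"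
    unfolding sup_norm_cube_def using one_in_cube
    by (intro cSUP_least convolution_error_le_resolution f) auto
  \<comment> \<open>Since \<open>sqrt 2\<close> is at most 2 and 2 at most \<open>pi\<close>, the
    stated constant is at least 4.\<close>
  also have "\<dots> \<le> 2 * (1 + pi / sqrt 2) * ?\<omega>"
  proof (intro mult_right_mono)
    have "sqrt 2 \<le> 2"
      by (simp add: real_le_lsqrt)
    also have "2 \<le> pi"
      by (rule pi_ge_two)
    finally have "1 \<le> pi / sqrt 2"
      by simp
    then have "2 * (1 + 1) \<le> 2 * (1 + pi / sqrt 2)"
      by (intro mult_left_mono add_left_mono) auto
    then show "3 \<le> 2 * (1 + pi / sqrt 2)"
      by (rule order_trans[rotated]) simp
  qed (use \<omega> in simp)
  finally show "sup_norm_cube (\<lambda>x. convolution (K r) f x - f x) \<le> 2 * (1 + pi / sqrt 2) * ?\<omega>" .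
qed

end
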